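(* Let $X$ be an infinite set. Let $T^A_X$ be the set of all $3$-cycles $(x,y,z)$ with $x,y,z \in X$ distinct, and let $U^A_X$ be the set of all products $(x,y)(z,u)$ with $x,y,z,u \in X$ distinct. Then $$C_{\mathrm{Alt}(X), T^A_X \cup U^A_X}(q) = \sum_{m=0}^\infty p(2m) q^m$$ $$= 1 + 2q + 5q^2 + 11q^3 + 22q^4 + 42q^5 + 77q^6 + 135q^7 + 231q^8 + 385q^9 + 627q^{10} + 1002q^{11} + 1575q^{12} + \cdots.$$
   Context: For a group $G$ generated by a set $S$: the word length $\ell_{G,S}(g)$ is the smallest $n \ge 0$ such that $g = s_1 \cdots s_n$ with $s_i \in S \cup S^{-1}$; the conjugacy length $\kappa_{G,S}(g)$ is the minimum of $\ell_{G,S}(h)$ over all $h$ in the conjugacy class of $g$; $\gamma_{G,S}(n)$ is the number of conjugacy classes of $G$ consisting of elements $g$ with $\kappa_{G,S}(g) = n$. When $\gamma_{G,S}(n)$ is finite for all $n$, the conjugacy growth series is $C_{G,S}(q) = \sum_{n=0}^\infty \gamma_{G,S}(n) q^n$. (Asserting a formula for $C_{G,S}$ includes the assertion that all $\gamma_{G,S}(n)$ are finite.) $\mathrm{Alt}(X)$ is the finitary alternating group of $X$: the group of permutations of $X$ with finite support and even signature. $p(m)$ is the number of partitions of $m$ (with $p(0)=1$). *)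

theory Defs
  imports
    "HOL-Algebra.Group_Action"
    "HOL-Algebra.Generated_Groups"
    "HOL-Combinatorics.Cycles"
    "HOL-Computational_Algebra.Formal_Power_Series"
begin

definition word_length :: "('a, 'b) monoid_scheme \<Rightarrow> 'a set \<Rightarrow> 'a \<Rightarrow> nat" where
  "word_length G S g =
     (LEAST n. \<exists>ws. length ws = n \<and> set ws \<subseteq> S \<union> m_inv G ` S \<and>
                    foldr (\<lambda>a b. a \<otimes>\<^bsub>G\<^esub> b) ws \<one>\<^bsub>G\<^esub> = g)"

definition conj_class :: "('a, 'b) monoid_scheme \<Rightarrow> 'a \<Rightarrow> 'a set" where
  "conj_class G x = orbit G (\<lambda>g h. g \<otimes>\<^bsub>G\<^esub> h \<otimes>\<^bsub>G\<^esub> inv\<^bsub>G\<^esub> g) x"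

definition conj_length :: "('a, 'b) monoid_scheme \<Rightarrow> 'a set \<Rightarrow> 'a \<Rightarrow> nat" where
  "conj_length G S g = (LEAST n. \<exists>h \<in> conj_class G g. word_length G S h = n)"

definition conj_classes_of_length ::
  "('a, 'b) monoid_scheme \<Rightarrow> 'a set \<Rightarrow> nat \<Rightarrow> 'a set set" where
  "conj_classes_of_length G S n =
     {C \<in> conj_class G ` carrier G. \<forall>g \<in> C. conj_length G S g = n}"

definition conj_growth :: "('a, 'b) monoid_scheme \<Rightarrow> 'a set \<Rightarrow> nat \<Rightarrow> nat" where
  "conj_growth G S n = card (conj_classes_of_length G S n)"

text \<open>The quantities above are meaningful only if \<open>S\<close> generates \<open>G\<close> (otherwise
  \<open>LEAST\<close> may range over an empty set) and if there are finitely many classes of each length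
  (otherwise \<open>card\<close> is \<open>0\<close>).  The following predicate records both requirements; a formula for
  the conjugacy growth series includes the assertion that it holds.\<close>

definition has_conj_growth_series :: "('a, 'b) monoid_scheme \<Rightarrow> 'a set \<Rightarrow> bool" where
  "has_conj_growth_series G S \<longleftrightarrow>
     group G \<and> S \<subseteq> carrier G \<and> generate G S = carrier G \<and>
     (\<forall>n. finite (conj_classes_of_length G S n))"

definition conj_growth_series :: "('a, 'b) monoid_scheme \<Rightarrow> 'a set \<Rightarrow> nat fps" where
  "conj_growth_series G S = Abs_fps (conj_growth G S)"

text \<open>\<^term>\<open>p permutes X\<close> allows infinite support, for which \<^const>\<open>evenperm\<close> is
  unspecified; \<^term>\<open>permutation p\<close> says that \<open>p\<close> is a bijection of finite support.\<close>

definition fin_alt_group :: "'a set \<Rightarrow> ('a \<Rightarrow> 'a) monoid" where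
  "fin_alt_group X =
     \<lparr>carrier = {p. p permutes X \<and> permutation p \<and> evenperm p}, monoid.mult = (\<circ>), one = id\<rparr>"

definition three_cycles :: "'a set \<Rightarrow> ('a \<Rightarrow> 'a) set" where
  "three_cycles X =
     {cycle_of_list [x, y, z] | x y z. {x, y, z} \<subseteq> X \<and> distinct [x, y, z]}"

definition double_transpositions :: "'a set \<Rightarrow> ('a \<Rightarrow> 'a) set" where
  "double_transpositions X =
     {transpose x y \<circ> transpose z u | x y z u. {x, y, z, u} \<subseteq> X \<and> distinct [x, y, z, u]}"

text \<open>A partition of \<open>m\<close> is a multiset of positive integers with sum \<open>m\<close>.\<close>

definition num_partitions :: "nat \<Rightarrow> nat" where
  "num_partitions m = card {M :: nat multiset. 0 \<notin># M \<and> sum_mset M = m}"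

end

theory Submission
  imports Defs
begin

text \<open>
  A product of \<open>n\<close> transpositions leaves invariant a labelling that loses at most \<open>n\<close> labels, so
  the least number of transpositions with product \<open>p\<close> is the sum of \<open>l - 1\<close> over the lengths \<open>l\<close>
  of the cycles of \<open>p\<close>.  The generators and the identity are exactly the products of two
  transpositions, hence the word length of an even \<open>p\<close> is half that sum.  Since \<open>X\<close> is infinite,
  an odd conjugator can be made even by a transposition disjoint from the support of \<open>p\<close>, so the
  conjugacy classes correspond to the multisets of the numbers \<open>l - 1 > 0\<close>; the classes of length
  \<open>n\<close> are the partitions of \<open>2n\<close>.
\<close>

text \<open>For finite support the forward orbits are the full cycles. The orbits are first
  collected as a set, so each cycle counts once although many points generate it;
  \<open>image_mset\<close> then keeps cycles of equal length apart. Recording length minus one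
  makes the sum of the multiset the least number of transpositions.\<close>

definition reduced_cycle_type :: "('a \<Rightarrow> 'a) \<Rightarrow> nat multiset" where
  "reduced_cycle_type p =
     image_mset (\<lambda>C. card C - 1) (mset_set ((\<lambda>x. range (\<lambda>n. (p ^^ n) x)) ` {x. p x \<noteq> x}))"

text \<open>Distinctness of the concatenation expresses at once that no list repeats an entry and
  that different positions hold disjoint lists. The length bound excludes lists that would denote
  the identity.\<close>

definition disjoint_cycles :: "'a list list \<Rightarrow> bool" where
  "disjoint_cycles css \<longleftrightarrow> distinct (concat css) \<and> (\<forall>c \<in> set css. 2 \<le> length c)"

fun perm_of_cycles :: "'a list list \<Rightarrow> 'a \<Rightarrow> 'a" where
  "perm_of_cycles [] = id"
| "perm_of_cycles (c # css) = cycle_of_list c \<circ> perm_of_cycles css"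

fun transps_of_cycle :: "'a list \<Rightarrow> ('a \<times> 'a) list" where
  "transps_of_cycle (x # y # c) = (x, y) # transps_of_cycle (y # c)"
| "transps_of_cycle c = []"

lemma disjoint_cycles_Cons:
  "disjoint_cycles (c # css) \<longleftrightarrow>
     distinct c \<and> 2 \<le> length c \<and> set c \<inter> set (concat css) = {} \<and> disjoint_cycles css"
  by (auto simp: disjoint_cycles_def)

section \<open>Products of disjoint cycles\<close>

lemma apply_transps_of_cycle: "apply_transps (transps_of_cycle c) = cycle_of_list c"
  by (induction c rule: transps_of_cycle.induct) auto

lemma length_transps_of_cycle: "length (transps_of_cycle c) = length c - 1"
  by (induction c rule: transps_of_cycle.induct) auto

lemma set_transps_of_cycle: "set (transps_of_cycle c) \<subseteq> set c \<times> set c"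
  by (induction c rule: transps_of_cycle.induct) auto

lemma transps_of_cycle_neq: "distinct c \<Longrightarrow> (a, b) \<in> set (transps_of_cycle c) \<Longrightarrow> a \<noteq> b"
  by (induction c rule: transps_of_cycle.induct) auto

lemma apply_transps_perm_of_cycles:
  "apply_transps (concat (map transps_of_cycle css)) = perm_of_cycles css"
  by (induction css) (auto simp: apply_transps_append apply_transps_of_cycle)

lemma perm_of_cycles_outside:
  "x \<notin> set (concat css) \<Longrightarrow> perm_of_cycles css x = x"
  by (induction css) (auto simp: id_outside_supp)

text \<open>All factors other than that of \<open>c\<close> fix every point of \<open>c\<close>, and
  the image of \<open>x\<close> stays in \<open>c\<close>, so the factors to the left do not move it
  further.\<close>

lemma perm_of_cycles_apply:
  assumes "distinct (concat css)" "c \<in> set css" "x \<in> set c"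
  shows "perm_of_cycles css x = cycle_of_list c x"
  using assms
proof (induction css)
  case (Cons d css)
  show ?case
  proof (cases "c = d")
    case True
    then have "x \<notin> set (concat css)"
      using Cons.prems by auto
    then show ?thesis
      using True by (simp add: perm_of_cycles_outside)
  next
    case False
    then have c: "c \<in> set css"
      using Cons.prems by auto
    have "cycle_of_list c x \<in> set c"
      using Cons.prems(3) permutes_in_image[OF cycle_permutes] by metis
    then have "cycle_of_list c x \<notin> set d"
      using c Cons.prems by auto
    then show ?thesis
      using c Cons by (simp add: id_outside_supp)
  qed
qed simp

text \<open>Applying a power of the cycle to its own list rotates the list, which turns iteration
  into index arithmetic modulo the length.\<close>

lemma cycle_of_list_funpow_nth:
  assumes "distinct c" "i < length c"
  shows "(cycle_of_list c ^^ n) (c ! i) = c ! ((n + i) mod length c)"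
proof -
  have "(cycle_of_list c ^^ n) (c ! i) = rotate n c ! i"
    using cyclic_rotation[OF assms(1), of n] assms(2) by (metis nth_map)
  then show ?thesis
    using assms(2) by (simp add: nth_rotate)
qed

lemma cycle_of_list_moves:
  assumes "distinct c" "2 \<le> length c" "x \<in> set c"
  shows "cycle_of_list c x \<noteq> x"
proof -
  obtain i where i: "i < length c" "x = c ! i"
    using assms(3) by (auto simp: in_set_conv_nth)
  have "(1 + i) mod length c \<noteq> i"
    using assms(2) i(1) by (auto simp: mod_if)
  moreover have "cycle_of_list c x = c ! ((1 + i) mod length c)"
    using cycle_of_list_funpow_nth[OF assms(1) i(1), of 1] i(2) by simp
  moreover have "(1 + i) mod length c < length c"
    using i(1) by (intro mod_less_divisor) linarith
  ultimately show ?thesis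
    using assms(1) i by (simp add: nth_eq_iff_index_eq)
qed

lemma orbit_perm_of_cycles:
  assumes "distinct (concat css)" "c \<in> set css" "x \<in> set c"
  shows "range (\<lambda>n. (perm_of_cycles css ^^ n) x) = set c"
proof -
  have c: "distinct c"
    using assms(1,2) by (auto simp: distinct_concat_iff)
  have in_c: "(cycle_of_list c ^^ n) x \<in> set c" for n
    using assms(3) permutes_in_image[OF permutes_funpow[OF cycle_permutes]] by metis
  have pow: "(perm_of_cycles css ^^ n) x = (cycle_of_list c ^^ n) x" for n
    by (induction n) (use in_c perm_of_cycles_apply[OF assms(1,2)] in simp_all)
  obtain i where i: "i < length c" "x = c ! i"
    using assms(3) by (auto simp: in_set_conv_nth)
  have "y \<in> range (\<lambda>n. (cycle_of_list c ^^ n) x)" if y: "y \<in> set c" for y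
  proof -
    obtain j where j: "j < length c" "y = c ! j"
      using y by (auto simp: in_set_conv_nth)
    \<comment> \<open>The exponent that leads from index \<open>i\<close> to index \<open>j\<close>
      is taken one full turn ahead, which avoids a truncated difference when \<open>j\<close> is
      below \<open>i\<close>.\<close>
    have "(length c - i + j + i) mod length c = j"
      using i(1) j(1) by simp
    then have "(cycle_of_list c ^^ (length c - i + j)) x = y"
      using cycle_of_list_funpow_nth[OF c i(1), of "length c - i + j"] i(2) j(2) by simp
    then show ?thesis
      by (metis rangeI)
  qed
  then show ?thesis
    using in_c by (auto simp: pow)
qed

lemma moved_perm_of_cycles:
  assumes "disjoint_cycles css"
  shows "{x. perm_of_cycles css x \<noteq> x} = set (concat css)"
proof (intro Set.set_eqI iffI)
  fix x
  assume "x \<in> set (concat css)"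
  then obtain c where c: "c \<in> set css" "x \<in> set c"
    by auto
  have "distinct c" "2 \<le> length c"
    using assms c(1) by (auto simp: disjoint_cycles_def distinct_concat_iff)
  then have "cycle_of_list c x \<noteq> x"
    using c(2) cycle_of_list_moves by fast
  moreover have "perm_of_cycles css x = cycle_of_list c x"
    using assms c by (intro perm_of_cycles_apply) (auto simp: disjoint_cycles_def)
  ultimately show "x \<in> {x. perm_of_cycles css x \<noteq> x}"
    by simp
next
  fix x
  assume "x \<in> {x. perm_of_cycles css x \<noteq> x}"
  then show "x \<in> set (concat css)"
    using perm_of_cycles_outside by (metis (mono_tags) mem_Collect_eq)
qed

text \<open>Disjoint nonempty lists have different entry sets; hence \<open>mset_set\<close> of the
  collection of cycles loses no multiplicity.\<close>

lemma distinct_map_set_cycles: "disjoint_cycles css \<Longrightarrow> distinct (map set css)"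
proof (induction css)
  case (Cons c css)
  have "set c \<noteq> set d" if "d \<in> set css" for d
  proof -
    have "set c \<noteq> {}" "set c \<inter> set d = {}"
      using Cons.prems that by (auto simp: disjoint_cycles_Cons)
    then show ?thesis
      by auto
  qed
  then show ?case
    using Cons by (auto simp: disjoint_cycles_Cons)
qed simp

text \<open>The orbits of moved points are exactly the entry sets of the lists. All later
  computations of the type go through this formula.\<close>

lemma reduced_cycle_type_perm_of_cycles:
  assumes "disjoint_cycles css"
  shows "reduced_cycle_type (perm_of_cycles css) = mset (map (\<lambda>c. length c - 1) css)"
proof -
  have d: "distinct (concat css)" and ne: "\<forall>c \<in> set css. c \<noteq> []"
    using assms by (auto simp: disjoint_cycles_def)
  let ?orb = "\<lambda>x. range (\<lambda>n. (perm_of_cycles css ^^ n) x)"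
  have "?orb ` set c = {set c}" if "c \<in> set css" for c
  proof -
    have "?orb ` set c = (\<lambda>x. set c) ` set c"
      using orbit_perm_of_cycles[OF d that] by (intro image_cong) auto
    then show ?thesis
      using ne that by (simp add: image_constant_conv)
  qed
  then have "?orb ` set (concat css) = set (map set css)"
    by (simp add: image_UN) blast
  then have "reduced_cycle_type (perm_of_cycles css) =
      image_mset (\<lambda>C. card C - 1) (mset (map set css))"
    unfolding reduced_cycle_type_def moved_perm_of_cycles[OF assms]
    by (simp only: mset_set_set[OF distinct_map_set_cycles[OF assms]])
  also have "\<dots> = mset (map (\<lambda>c. card (set c) - 1) css)"
    by (simp add: multiset.map_comp o_def)
  also have "\<dots> = mset (map (\<lambda>c. length c - 1) css)"
  proof -
    have "card (set c) = length c" if "c \<in> set css" for c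
      using d that by (intro distinct_card) (auto simp: distinct_concat_iff)
    then show ?thesis
      by (simp cong: map_cong)
  qed
  finally show ?thesis .
qed

lemma exists_disjoint_cycles:
  assumes "permutation p"
  obtains css where "disjoint_cycles css" "perm_of_cycles css = p"
proof -
  \<comment> \<open>The inclusion in \<open>I\<close> is carried through the induction because it
    makes the next cycle disjoint from those already found.\<close>
  have *: "\<exists>css. disjoint_cycles css \<and> perm_of_cycles css = p \<and> set (concat css) \<subseteq> I"
    if "cycle_decomp I p" for I and p :: "'a \<Rightarrow> 'a"
    using that
  proof (induction rule: cycle_decomp.induct)
    case empty
    show ?case
      by (intro exI[of _ "[]"]) (simp add: disjoint_cycles_def)
  next
    case (comp I p c)
    then obtain css where css: "disjoint_cycles css" "perm_of_cycles css = p" "set (concat css) \<subseteq> I"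
      by blast
    show ?case
    proof (cases "2 \<le> length c")
      case True
      then show ?thesis
        using comp css by (intro exI[of _ "c # css"]) (auto simp: disjoint_cycles_Cons)
    next
      \<comment> \<open>\<open>cycle_decomp\<close> admits lists with at most one entry; these
        denote the identity and are dropped.\<close>
      case False
      then have "cycle_of_list c = id"
        by (cases c rule: transps_of_cycle.cases) auto
      then show ?thesis
        using css by (intro exI[of _ css]) auto
    qed
  qed
  show ?thesis
    using assms * cycle_decomposition that unfolding permutation_permutes by metis
qed

lemma permutation_perm_of_cycles: "permutation (perm_of_cycles css)"
  by (induction css) (auto intro!: permutation_compose permutation_of_cycle simp del: o_apply)

lemma perm_of_cycles_permutes:
  "set (concat css) \<subseteq> X \<Longrightarrow> perm_of_cycles css permutes X"
  using permutation_bijective[OF permutation_perm_of_cycles[of css]] perm_of_cycles_outside[of _ css]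
  unfolding permutes_def bij_iff by blast

lemma transps_of_cycles_neq:
  assumes "distinct (concat css)" "(a, b) \<in> set (concat (map transps_of_cycle css))"
  shows "a \<noteq> b"
  using assms by (induction css) (auto dest: transps_of_cycle_neq)

text \<open>A cycle of length \<open>l\<close> is written with \<open>l - 1\<close> transpositions,
  and parity counts them modulo two.\<close>

lemma evenperm_perm_of_cycles:
  assumes "distinct (concat css)"
  shows "evenperm (perm_of_cycles css) \<longleftrightarrow> even (\<Sum>c\<leftarrow>css. length c - 1)"
proof -
  have "\<forall>(a, b) \<in> set (concat (map transps_of_cycle css)). a \<noteq> b"
    using transps_of_cycles_neq[OF assms] by blast
  from evenperm_apply_transps_iff[OF this] show ?thesis
    by (simp add: apply_transps_perm_of_cycles length_concat length_transps_of_cycle o_def)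
qed

section \<open>Conjugation, parity and the reduced cycle type\<close>

lemma conjugate_perm_of_cycles:
  assumes "bij g" "distinct (concat css)"
  shows "g \<circ> perm_of_cycles css \<circ> inv_into UNIV g = perm_of_cycles (map (map g) css)"
  using assms(2)
proof (induction css)
  case Nil
  then show ?case
    using assms(1) by (simp add: bij_is_surj surj_f_inv_f fun_eq_iff)
next
  case (Cons c css)
  \<comment> \<open>Inserting \<open>inv_into UNIV g \<circ> g\<close> between the factors
    conjugates each of them separately; conjugating a single cycle relabels its entries.\<close>
  have "g \<circ> perm_of_cycles (c # css) \<circ> inv_into UNIV g =
      (g \<circ> cycle_of_list c \<circ> inv_into UNIV g) \<circ> (g \<circ> perm_of_cycles css \<circ> inv_into UNIV g)"
    using assms(1) by (simp add: fun_eq_iff bij_is_inj)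
  also have "g \<circ> cycle_of_list c \<circ> inv_into UNIV g = cycle_of_list (map g c)"
    using Cons.prems assms(1) by (intro conjugation_of_cycle) auto
  also have "g \<circ> perm_of_cycles css \<circ> inv_into UNIV g = perm_of_cycles (map (map g) css)"
    using Cons.prems by (intro Cons.IH) simp
  finally show ?case
    by simp
qed

lemma disjoint_cycles_map:
  "bij g \<Longrightarrow> disjoint_cycles css \<Longrightarrow> disjoint_cycles (map (map g) css)"
  by (auto simp: disjoint_cycles_def distinct_map simp flip: map_concat dest!: bij_is_inj intro: inj_on_subset)

lemma reduced_cycle_type_conjugate:
  assumes "permutation p" "bij g"
  shows "reduced_cycle_type (g \<circ> p \<circ> inv_into UNIV g) = reduced_cycle_type p"
proof -
  obtain css where css: "disjoint_cycles css" "perm_of_cycles css = p"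
    using exists_disjoint_cycles[OF assms(1)] by metis
  then have "g \<circ> p \<circ> inv_into UNIV g = perm_of_cycles (map (map g) css)"
    using conjugate_perm_of_cycles[OF assms(2)] by (auto simp: disjoint_cycles_def)
  then show ?thesis
    using css disjoint_cycles_map[OF assms(2) css(1)]
    by (auto simp: reduced_cycle_type_perm_of_cycles o_def)
qed

lemma zero_notin_reduced_cycle_type:
  assumes "permutation p"
  shows "0 \<notin># reduced_cycle_type p"
proof -
  obtain css where css: "disjoint_cycles css" "perm_of_cycles css = p"
    using exists_disjoint_cycles[OF assms] by metis
  have "2 \<le> length c" if "c \<in> set css" for c
    using css(1) that by (auto simp: disjoint_cycles_def)
  then show ?thesis
    using reduced_cycle_type_perm_of_cycles[OF css(1)] css(2) by fastforce
qed

lemma evenperm_iff_reduced_cycle_type: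
  assumes "permutation p"
  shows "evenperm p \<longleftrightarrow> even (sum_mset (reduced_cycle_type p))"
proof -
  obtain css where css: "disjoint_cycles css" "perm_of_cycles css = p"
    using exists_disjoint_cycles[OF assms] by metis
  have "sum_mset (reduced_cycle_type p) = (\<Sum>c\<leftarrow>css. length c - 1)"
    using reduced_cycle_type_perm_of_cycles[OF css(1)] css(2) by (metis sum_mset_sum_list)
  then show ?thesis
    using evenperm_perm_of_cycles[of css] css by (simp add: disjoint_cycles_def)
qed

section \<open>Word length\<close>

text \<open>Multiplying by a transposition can merge at most two of the classes on which a
  \<open>p\<close>-invariant labelling \<open>f\<close> is constant.\<close>

lemma swapidseq_invariant_labelling:
  assumes "swapidseq n p"
  shows "\<exists>f :: 'a \<Rightarrow> 'a. (\<forall>x. f (p x) = f x) \<and> (\<forall>S. finite S \<longrightarrow> card S \<le> card (f ` S) + n)"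
  using assms
proof (induction rule: swapidseq.induct)
  case id
  show ?case
    by (intro exI[of _ id]) simp
next
  case (comp_Suc n p a b)
  then obtain f :: "'a \<Rightarrow> 'a" where inv: "\<And>x. f (p x) = f x"
    and card: "\<And>S. finite S \<Longrightarrow> card S \<le> card (f ` S) + n"
    by blast
  \<comment> \<open>Identifying the labels \<open>f a\<close> and \<open>f b\<close> makes the
    labelling blind to \<open>transpose a b\<close>; the only value that can disappear is
    \<open>f b\<close>.\<close>
  define h where "h x = (if f x = f b then f a else f x)" for x
  have h_transpose: "h (transpose a b x) = h x" for x
    by (auto simp: h_def transpose_def)
  have "h ((transpose a b \<circ> p) x) = h x" for x
    unfolding o_apply h_transpose by (simp add: h_def inv)
  moreover have "card S \<le> card (h ` S) + Suc n" if "finite S" for S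
  proof -
    have "f ` S \<subseteq> insert (f b) (h ` S)"
      by (auto simp: h_def)
    then have "card (f ` S) \<le> card (insert (f b) (h ` S))"
      using that by (intro card_mono) auto
    also have "\<dots> \<le> Suc (card (h ` S))"
      by (rule card_insert_le_m1) auto
    finally show ?thesis
      using card[OF that] by linarith
  qed
  ultimately show ?case
    by blast
qed

text \<open>An invariant labelling is constant on each cycle, so on the moved points it takes at
  most as many values as there are cycles. The number of moved points minus the number of cycles is
  therefore at most \<open>n\<close>, and this difference is the sum of the type.\<close>

lemma reduced_cycle_type_le_swapidseq:
  fixes p :: "'a \<Rightarrow> 'a"
  assumes "swapidseq n p"
  shows "sum_mset (reduced_cycle_type p) \<le> n"
proof -
  have "permutation p"
    using assms by (auto simp: permutation_def)
  then obtain css where css: "disjoint_cycles css" "perm_of_cycles css = p"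
    using exists_disjoint_cycles by metis
  then have d: "distinct (concat css)"
    by (simp add: disjoint_cycles_def)
  obtain f :: "'a \<Rightarrow> 'a" where inv: "\<And>x. f (p x) = f x"
    and card: "\<And>S. finite S \<Longrightarrow> card S \<le> card (f ` S) + n"
    using swapidseq_invariant_labelling[OF assms] by metis
  have funpow: "f ((p ^^ k) x) = f x" for k x
    by (induction k) (auto simp: inv)
  have const: "f x = f (hd c)" if c: "c \<in> set css" and x: "x \<in> set c" for c x
  proof -
    have "hd c \<in> set c"
      using x by (cases c) auto
    then obtain k where "x = (p ^^ k) (hd c)"
      using orbit_perm_of_cycles[OF d c, of "hd c"] css(2) x by blast
    then show ?thesis
      by (simp add: funpow)
  qed
  have "f ` set (concat css) \<subseteq> (\<lambda>c. f (hd c)) ` set css"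
    using const by auto
  then have "card (f ` set (concat css)) \<le> length css"
    by (meson List.finite_set card_length card_image_le card_mono finite_imageI le_trans)
  then have "length (concat css) \<le> length css + n"
    using card[of "set (concat css)"] distinct_card[OF d] by simp
  moreover have "length (concat css) = length css + (\<Sum>c\<leftarrow>css. length c - 1)"
    using css(1) by (induction css) (auto simp: disjoint_cycles_Cons simp del: perm_of_cycles.simps)
  moreover have "sum_mset (reduced_cycle_type p) = (\<Sum>c\<leftarrow>css. length c - 1)"
    using reduced_cycle_type_perm_of_cycles[OF css(1)] css(2) by (metis sum_mset_sum_list)
  ultimately show ?thesis
    by simp
qed

section \<open>The finitary alternating group as a group\<close>

lemma carrier_fin_alt_group:
  "p \<in> carrier (fin_alt_group X) \<longleftrightarrow> p permutes X \<and> permutation p \<and> evenperm p"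
  by (simp add: fin_alt_group_def)

lemma mult_fin_alt_group [simp]: "x \<otimes>\<^bsub>fin_alt_group X\<^esub> y = x \<circ> y"
  by (simp add: fin_alt_group_def)

lemma one_fin_alt_group [simp]: "\<one>\<^bsub>fin_alt_group X\<^esub> = id"
  by (simp add: fin_alt_group_def)

lemma inv_in_fin_alt_group:
  assumes "p \<in> carrier (fin_alt_group X)"
  shows "inv_into UNIV p \<in> carrier (fin_alt_group X)"
  using assms
  by (simp add: carrier_fin_alt_group permutes_inv permutation_inverse evenperm_inv)

lemma group_fin_alt_group: "group (fin_alt_group X)"
proof (rule groupI)
  fix p
  assume p: "p \<in> carrier (fin_alt_group X)"
  then have "inv_into UNIV p \<circ> p = id"
    using permutes_inv_o(2)[of p X] by (simp add: carrier_fin_alt_group)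
  then show "\<exists>q \<in> carrier (fin_alt_group X). q \<otimes>\<^bsub>fin_alt_group X\<^esub> p = \<one>\<^bsub>fin_alt_group X\<^esub>"
    using inv_in_fin_alt_group[OF p] by auto
qed (auto simp: carrier_fin_alt_group permutes_compose permutation_compose evenperm_comp
      permutes_id o_assoc simp del: o_apply)

lemma m_inv_fin_alt_group:
  assumes "p \<in> carrier (fin_alt_group X)"
  shows "m_inv (fin_alt_group X) p = inv_into UNIV p"
proof (rule group.inv_equality[OF group_fin_alt_group])
  show "inv_into UNIV p \<otimes>\<^bsub>fin_alt_group X\<^esub> p = \<one>\<^bsub>fin_alt_group X\<^esub>"
    using assms permutes_inv_o(2)[of p X] by (simp add: carrier_fin_alt_group)
qed (use assms inv_in_fin_alt_group in auto)

section \<open>Generators as products of two transpositions\<close>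

abbreviation alt_generators :: "'a set \<Rightarrow> ('a \<Rightarrow> 'a) set" where
  "alt_generators X \<equiv> three_cycles X \<union> double_transpositions X"

text \<open>A 3-cycle is \<open>transpose x y \<circ> transpose y z\<close>, so both kinds of
  generator get one common form, in which the two transpositions may share a point.\<close>

lemma alt_generator_cases:
  assumes "s \<in> alt_generators X"
  obtains a b c d where "{a, b, c, d} \<subseteq> X" "a \<noteq> b" "c \<noteq> d" "s = transpose a b \<circ> transpose c d"
proof -
  from assms consider "s \<in> three_cycles X" | "s \<in> double_transpositions X"
    by (rule UnE)
  then show ?thesis
  proof cases
    case 1
    then obtain x y z where "{x, y, z} \<subseteq> X" "distinct [x, y, z]" "s = cycle_of_list [x, y, z]"
      unfolding three_cycles_def mem_Collect_eq by (elim exE conjE) (rule that)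
    then show ?thesis
      using that[of x y y z] by simp
  next
    case 2
    then obtain x y z u where "{x, y, z, u} \<subseteq> X" "distinct [x, y, z, u]"
        "s = transpose x y \<circ> transpose z u"
      unfolding double_transpositions_def mem_Collect_eq by (elim exE conjE) (rule that)
    then show ?thesis
      using that[of x y z u] by simp
  qed
qed

lemma swapidseq_two: "a \<noteq> b \<Longrightarrow> c \<noteq> d \<Longrightarrow> swapidseq 2 (transpose a b \<circ> transpose c d)"
  using comp_Suc[OF comp_Suc[OF swapidseq.id], of c d a b] by (simp add: numeral_2_eq_2)

lemma swapidseq_alt_generator: "s \<in> alt_generators X \<Longrightarrow> swapidseq 2 s"
  by (erule alt_generator_cases) (simp add: swapidseq_two)

lemma alt_generators_subset: "alt_generators X \<subseteq> carrier (fin_alt_group X)"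
proof
  fix s
  assume s: "s \<in> alt_generators X"
  then obtain a b c d where "{a, b, c, d} \<subseteq> X" "s = transpose a b \<circ> transpose c d"
    by (rule alt_generator_cases)
  then have "s permutes X"
    by (auto intro!: permutes_compose permutes_swap_id simp del: o_apply)
  then show "s \<in> carrier (fin_alt_group X)"
    using swapidseq_alt_generator[OF s] evenperm_unique[of 2 s True]
    by (auto simp: carrier_fin_alt_group permutation_def)
qed

text \<open>The product is decided by the overlap of the two pairs: disjoint pairs give a double
  transposition, one common point gives a 3-cycle, and equal pairs cancel to
  \<open>id\<close>.\<close>

lemma two_transpositions_alt_generator:
  assumes "{a, b, c, d} \<subseteq> X" "a \<noteq> b" "c \<noteq> d"
  shows "transpose a b \<circ> transpose c d \<in> insert id (alt_generators X)"
proof -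
  have three: "transpose x y \<circ> transpose y z \<in> alt_generators X"
    if "{x, y, z} \<subseteq> X" "distinct [x, y, z]" for x y z
  proof -
    have "transpose x y \<circ> transpose y z = cycle_of_list [x, y, z]"
      by simp
    then show ?thesis
      using that unfolding three_cycles_def by blast
  qed
  \<comment> \<open>After the disjoint case come the two orientations of equal pairs and the four
    ways to share exactly one point; in the last four, swapping the entries of a transposition where
    necessary puts the common point in the middle.\<close>
  consider "distinct [a, b, c, d]" | "a = c" "b = d" | "a = d" "b = c"
    | "b = c" "a \<noteq> d" | "b = d" "a \<noteq> c" | "a = c" "b \<noteq> d" | "a = d" "b \<noteq> c"
    using assms(2,3) by auto
  then show ?thesis
  proof cases
    case 1
    then show ?thesis
      using assms(1) unfolding double_transpositions_def by blast
  next
    case 2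
    then show ?thesis
      by simp
  next
    case 3
    then show ?thesis
      using transpose_commute[of c d] by simp
  next
    case 4
    then show ?thesis
      using three[of a b d] assms by simp
  next
    case 5
    then show ?thesis
      using three[of a b c] assms transpose_commute[of c d] by simp
  next
    case 6
    then show ?thesis
      using three[of b a d] assms transpose_commute[of a b] by simp
  next
    case 7
    then show ?thesis
      using three[of b a c] assms transpose_commute[of a b] transpose_commute[of c d] by simp
  qed
qed

lemma foldr_comp_Cons: "foldr (\<circ>) (w # ws) id = w \<circ> foldr (\<circ>) ws id"
  unfolding foldr_Cons o_apply ..

text \<open>Consecutive transpositions are paired off. A pair that cancels contributes no letter,
  which is why the length is only bounded by \<open>n\<close>.\<close>

lemma word_of_transpositions:
  assumes "length ts = 2 * n" "\<And>a b. (a, b) \<in> set ts \<Longrightarrow> a \<in> X \<and> b \<in> X \<and> a \<noteq> b"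
  shows "\<exists>ws. length ws \<le> n \<and> set ws \<subseteq> alt_generators X \<and> foldr (\<circ>) ws id = apply_transps ts"
  using assms
proof (induction n arbitrary: ts)
  case 0
  show ?case
    using "0.prems"(1) by (intro exI[of _ "[]"]) simp
next
  case (Suc n)
  have "length ts = Suc (Suc (2 * n))"
    using Suc.prems(1) by simp
  then obtain t t' us where tt': "ts = t # t' # us"
    unfolding length_Suc_conv by blast
  obtain a b c d where "t = (a, b)" "t' = (c, d)"
    by (metis surj_pair)
  then have ts: "ts = (a, b) # (c, d) # us"
    using tt' by simp
  have us: "length us = 2 * n"
    using Suc.prems(1) ts by simp
  have "x \<in> X \<and> y \<in> X \<and> x \<noteq> y" if "(x, y) \<in> set us" for x y
    using Suc.prems(2)[of x y] that ts by simp
  then obtain ws where ws: "length ws \<le> n" "set ws \<subseteq> alt_generators X"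
    "foldr (\<circ>) ws id = apply_transps us"
    using Suc.IH[OF us] by blast
  let ?g = "transpose a b \<circ> transpose c d"
  have "?g \<in> insert id (alt_generators X)"
    using Suc.prems(2)[of a b] Suc.prems(2)[of c d] ts
    by (intro two_transpositions_alt_generator) simp_all
  moreover have eq: "apply_transps ts = ?g \<circ> foldr (\<circ>) ws id"
    by (simp add: ts ws(3) comp_assoc)
  ultimately consider "?g = id" | "?g \<in> alt_generators X"
    by blast
  then show ?case
  proof cases
    case 1
    have "foldr (\<circ>) ws id = apply_transps ts"
      unfolding eq 1 by simp
    then show ?thesis
      using ws(1,2) le_SucI by blast
  next
    case 2
    have "foldr (\<circ>) (?g # ws) id = apply_transps ts"
      unfolding eq foldr_comp_Cons ..
    moreover have "length (?g # ws) \<le> Suc n" "set (?g # ws) \<subseteq> alt_generators X"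
      using ws(1,2) 2 by auto
    ultimately show ?thesis
      by blast
  qed
qed

text \<open>The upper bound for the word length: each cycle is expanded into transpositions of its
  entries, which lie in \<open>X\<close> because \<open>p\<close> moves them. Their total number is
  the sum of the type, which is even.\<close>

lemma word_of_even_permutation:
  assumes "p \<in> carrier (fin_alt_group X)"
  obtains ws where "2 * length ws \<le> sum_mset (reduced_cycle_type p)"
    "set ws \<subseteq> alt_generators X" "foldr (\<circ>) ws id = p"
proof -
  have p: "p permutes X" "permutation p" "evenperm p"
    using assms by (auto simp: carrier_fin_alt_group)
  obtain css where css: "disjoint_cycles css" "perm_of_cycles css = p"
    using exists_disjoint_cycles[OF p(2)] by metis
  let ?ts = "concat (map transps_of_cycle css)"
  obtain n where n: "sum_mset (reduced_cycle_type p) = 2 * n"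
    using p(3) evenperm_iff_reduced_cycle_type[OF p(2)] by (auto elim: evenE)
  have "sum_mset (reduced_cycle_type p) = (\<Sum>c\<leftarrow>css. length c - 1)"
    using reduced_cycle_type_perm_of_cycles[OF css(1)] css(2) by (metis sum_mset_sum_list)
  then have len: "length ?ts = 2 * n"
    using n by (simp add: length_concat length_transps_of_cycle o_def)
  have "set (concat css) \<subseteq> X"
    using moved_perm_of_cycles[OF css(1)] css(2) p(1) by (auto simp: permutes_def)
  moreover have "set ?ts \<subseteq> set (concat css) \<times> set (concat css)"
    using set_transps_of_cycle by fastforce
  moreover have "a \<noteq> b" if "(a, b) \<in> set ?ts" for a b
    using transps_of_cycles_neq[OF _ that] css(1) unfolding disjoint_cycles_def by blast
  ultimately have "a \<in> X \<and> b \<in> X \<and> a \<noteq> b" if "(a, b) \<in> set ?ts" for a b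
    using that by blast
  then have "\<exists>ws. length ws \<le> n \<and> set ws \<subseteq> alt_generators X \<and>
      foldr (\<circ>) ws id = apply_transps ?ts"
    by (rule word_of_transpositions[OF len])
  then obtain ws where ws: "length ws \<le> n" "set ws \<subseteq> alt_generators X"
    "foldr (\<circ>) ws id = p"
    unfolding apply_transps_perm_of_cycles css(2) by blast
  then show ?thesis
    using that[of ws] n by linarith
qed

lemma swapidseq_word:
  "(\<And>s. s \<in> set ws \<Longrightarrow> swapidseq 2 s) \<Longrightarrow> swapidseq (2 * length ws) (foldr (\<circ>) ws id)"
proof (induction ws)
  case (Cons w ws)
  have "swapidseq 2 w" "swapidseq (2 * length ws) (foldr (\<circ>) ws id)"
    by (rule Cons.prems, simp) (rule Cons.IH, rule Cons.prems, simp)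
  then have "swapidseq (2 + 2 * length ws) (w \<circ> foldr (\<circ>) ws id)"
    by (rule swapidseq_comp_add)
  then show ?case
    by (simp only: foldr_comp_Cons length_Cons mult_Suc_right)
qed simp

text \<open>Every letter is a product of two transpositions, so a word for \<open>p\<close> has at
  least half as many letters as the sum of the type; the word built from the cycles attains this
  bound.\<close>

lemma word_length_fin_alt_group:
  assumes "p \<in> carrier (fin_alt_group X)"
  shows "2 * word_length (fin_alt_group X) (alt_generators X) p = sum_mset (reduced_cycle_type p)"
proof -
  have "even (sum_mset (reduced_cycle_type p))"
    using assms evenperm_iff_reduced_cycle_type by (auto simp: carrier_fin_alt_group)
  then obtain n where n: "sum_mset (reduced_cycle_type p) = 2 * n"
    by (rule evenE)
  let ?S = "alt_generators X \<union> m_inv (fin_alt_group X) ` alt_generators X"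
  \<comment> \<open>Inverse generators are covered as well, since inversion preserves the number of
    transpositions.\<close>
  have swap: "swapidseq 2 s" if "s \<in> ?S" for s
  proof -
    obtain t where t: "t \<in> alt_generators X" "s = t \<or> s = m_inv (fin_alt_group X) t"
      using \<open>s \<in> ?S\<close> by blast
    have "m_inv (fin_alt_group X) t = inv_into UNIV t"
      using alt_generators_subset t(1) by (intro m_inv_fin_alt_group) (rule subsetD)
    then show ?thesis
      using t(2) swapidseq_alt_generator[OF t(1)] swapidseq_inverse[of 2 t] by (elim disjE) simp_all
  qed
  have lower: "n \<le> length ws" if "set ws \<subseteq> ?S" "foldr (\<circ>) ws id = p" for ws
  proof -
    have "swapidseq (2 * length ws) p"
      using swapidseq_word[of ws] swap that by blast
    then show ?thesis
      using reduced_cycle_type_le_swapidseq[of "2 * length ws" p] n by simp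
  qed
  obtain ws where ws: "2 * length ws \<le> 2 * n" "set ws \<subseteq> alt_generators X" "foldr (\<circ>) ws id = p"
    using word_of_even_permutation[OF assms] n by metis
  have "word_length (fin_alt_group X) (alt_generators X) p = n"
    unfolding word_length_def mult_fin_alt_group one_fin_alt_group
  proof (rule Least_equality)
    have "length ws = n" "set ws \<subseteq> ?S"
      using lower[of ws] ws by auto
    then show "\<exists>ws. length ws = n \<and> set ws \<subseteq> ?S \<and> foldr (\<circ>) ws id = p"
      using ws(3) by blast
  qed (use lower in blast)
  then show ?thesis
    using n by simp
qed

lemma generate_alt_generators:
  "generate (fin_alt_group X) (alt_generators X) = carrier (fin_alt_group X)"
proof
  show "generate (fin_alt_group X) (alt_generators X) \<subseteq> carrier (fin_alt_group X)"
    using group.generate_incl[OF group_fin_alt_group alt_generators_subset] .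
  have "foldr (\<circ>) ws id \<in> generate (fin_alt_group X) (alt_generators X)"
    if "set ws \<subseteq> alt_generators X" for ws
    using that
  proof (induction ws)
    case Nil
    show ?case
        using generate.one[of "fin_alt_group X"] by (simp add: id_def)
  next
    case (Cons w ws)
    have "w \<in> generate (fin_alt_group X) (alt_generators X)"
      using Cons.prems by (intro generate.incl) simp
    moreover have "foldr (\<circ>) ws id \<in> generate (fin_alt_group X) (alt_generators X)"
      by (rule Cons.IH) (use Cons.prems in simp)
    ultimately have "w \<otimes>\<^bsub>fin_alt_group X\<^esub> foldr (\<circ>) ws id \<in>
        generate (fin_alt_group X) (alt_generators X)"
      by (rule generate.eng)
    then show ?case
      unfolding foldr_comp_Cons mult_fin_alt_group .
  qed
  then show "carrier (fin_alt_group X) \<subseteq> generate (fin_alt_group X) (alt_generators X)"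
    by (metis subsetI word_of_even_permutation)
qed

section \<open>Conjugacy classes\<close>

lemma exists_permutation_map:
  assumes "distinct xs" "distinct ys" "length xs = length ys" "set xs \<subseteq> X" "set ys \<subseteq> X"
  obtains g where "g permutes X" "permutation g" "map g xs = ys"
proof -
  have "\<exists>g. g permutes X \<and> permutation g \<and> map g xs = ys"
    using assms(3,1,2,4,5)
  proof (induction xs ys rule: list_induct2)
    case Nil
    have "id permutes X \<and> permutation id \<and> map id [] = ([] :: 'a list)"
      by simp
    then show ?case
      by (rule exI[of _ id])
  next
    case (Cons x xs y ys)
    have "\<exists>g. g permutes X \<and> permutation g \<and> map g xs = ys"
      by (rule Cons.IH) (use Cons.prems in simp_all)
    then obtain g where g: "g permutes X" "permutation g" "map g xs = ys"
      by blast
    \<comment> \<open>The correction sends \<open>x\<close> to \<open>y\<close> and leaves the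
      earlier images alone: they differ from \<open>g x\<close> by injectivity and from
      \<open>y\<close> by distinctness of the target list.\<close>
    let ?h = "transpose (g x) y \<circ> g"
    have "g x \<in> X" "y \<in> X"
      using Cons.prems g(1) by (simp_all add: permutes_in_image)
    then have "?h permutes X"
      by (intro permutes_compose permutes_swap_id g(1))
    moreover have "permutation ?h"
      by (intro permutation_compose permutation_swap_id g(2))
    moreover have "map ?h (x # xs) = y # ys"
    proof -
      have "?h z = g z" if "z \<in> set xs" for z
      proof -
        have "g z \<in> set ys"
          using that g(3) by auto
        moreover have "g z \<noteq> g x"
          using that Cons.prems(1) permutes_inj[OF g(1)] by (auto simp: inj_eq)
        ultimately show ?thesis
          using Cons.prems(2) by (auto simp: transpose_eq_iff)
      qed
      then have "map ?h xs = map g xs"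
        by (intro map_cong refl)
      then show ?thesis
        using g(3) by simp
    qed
    ultimately have "?h permutes X \<and> permutation ?h \<and> map ?h (x # xs) = y # ys"
      by blast
    then show ?case
      by (rule exI[of _ ?h])
  qed
  then show ?thesis
    using that by blast
qed

text \<open>The requirement concerns only the points of \<open>xs\<close>. As \<open>X\<close> is
  infinite, two further points exist, and precomposing with their transposition flips the parity
  without changing the images of \<open>xs\<close>.\<close>

lemma exists_even_permutation_map:
  assumes "infinite X"
    and "distinct xs" "distinct ys" "length xs = length ys" "set xs \<subseteq> X" "set ys \<subseteq> X"
  obtains g where "g \<in> carrier (fin_alt_group X)" "map g xs = ys"
proof -
  obtain g where g: "g permutes X" "permutation g" "map g xs = ys"
    using exists_permutation_map[OF assms(2-6)] by metis
  show ?thesis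
  proof (cases "evenperm g")
    case True
    then show ?thesis
      using g that by (simp add: carrier_fin_alt_group)
  next
    case False
    have "infinite (X - set xs)"
      using assms(1) by simp
    then obtain a where a: "a \<in> X - set xs"
      using infinite_imp_nonempty by blast
    have "infinite (X - set xs - {a})"
      using assms(1) by simp
    then obtain b where b: "b \<in> X - set xs - {a}"
      using infinite_imp_nonempty by blast
    let ?h = "g \<circ> transpose a b"
    have "?h permutes X"
      using a b g(1) by (intro permutes_compose permutes_swap_id) auto
    moreover have "permutation ?h"
      using g(2) by (intro permutation_compose permutation_swap_id)
    moreover have "evenperm ?h"
      using evenperm_comp[OF g(2) permutation_swap_id[of a b]] False b by (auto simp: evenperm_swap)
    moreover have "map ?h xs = ys"
    proof -
      have "?h z = g z" if "z \<in> set xs" for z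
        using a b that by (auto simp: transpose_def)
      then show ?thesis
        using g(3) by (metis map_cong)
    qed
    ultimately show ?thesis
      using that by (simp add: carrier_fin_alt_group)
  qed
qed

text \<open>Equal block lengths allow an equation between flattened lists to be cut back into
  cycles.\<close>

lemma map_map_concat_eq:
  assumes "map length css = map length dss" "map g (concat css) = concat dss"
  shows "map (map g) css = dss"
  using assms
proof (induction css arbitrary: dss)
  case (Cons c css)
  then obtain d ds where dss: "dss = d # ds"
    by (cases dss) auto
  then have "map g c @ map g (concat css) = d @ concat ds" "length (map g c) = length d"
    using Cons.prems by auto
  then show ?case
    using Cons dss by auto
qed simp

text \<open>The value at a point depends only on the list that contains it, so the order of disjoint
  cycles is immaterial.\<close>

lemma perm_of_cycles_cong:
  assumes "distinct (concat css)" "distinct (concat dss)" "set css = set dss"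
  shows "perm_of_cycles css = perm_of_cycles dss"
proof
  fix x
  show "perm_of_cycles css x = perm_of_cycles dss x"
  proof (cases "x \<in> set (concat css)")
    case True
    then obtain c where "c \<in> set css" "x \<in> set c"
      by auto
    then show ?thesis
      using assms by (simp add: perm_of_cycles_apply)
  next
    case False
    then show ?thesis
      using assms(3) by (simp add: perm_of_cycles_outside)
  qed
qed

text \<open>The cycles of \<open>q\<close> are reordered to match those of \<open>p\<close> in
  length; an even permutation that carries the entries of the one list of cycles to those of the
  other is then a conjugator.\<close>

lemma conjugate_in_fin_alt_group:
  assumes "infinite X" "p \<in> carrier (fin_alt_group X)" "q \<in> carrier (fin_alt_group X)"
    and "reduced_cycle_type p = reduced_cycle_type q"
  obtains g where "g \<in> carrier (fin_alt_group X)" "g \<circ> p \<circ> inv_into UNIV g = q"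
proof -
  have p: "p permutes X" "permutation p" and q: "q permutes X" "permutation q"
    using assms(2,3) by (auto simp: carrier_fin_alt_group)
  obtain css where css: "disjoint_cycles css" "perm_of_cycles css = p"
    using exists_disjoint_cycles[OF p(2)] by metis
  obtain dss' where dss': "disjoint_cycles dss'" "perm_of_cycles dss' = q"
    using exists_disjoint_cycles[OF q(2)] by metis
  have in_X: "set (concat css) \<subseteq> X" "set (concat dss') \<subseteq> X"
    using moved_perm_of_cycles[OF css(1)] css(2) p(1)
      moved_perm_of_cycles[OF dss'(1)] dss'(2) q(1) unfolding permutes_def by blast+
  let ?l = "\<lambda>c :: 'a list. length c - 1"
  have "mset (map ?l css) = mset (map ?l dss')"
    using assms(4) css dss' by (metis reduced_cycle_type_perm_of_cycles)
  then obtain f where f: "f permutes {..<length (map ?l dss')}" "permute_list f (map ?l dss') = map ?l css"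
    by (rule mset_eq_permutation)
  define dss where "dss = permute_list f dss'"
  have mset_dss: "mset dss = mset dss'"
    using f(1) by (simp add: dss_def)
  then have set_dss: "set dss = set dss'"
    by (metis set_mset_mset)
  have "mset (concat dss) = mset (concat dss')"
    unfolding mset_concat sum_mset_sum_list[symmetric] mset_map mset_dss ..
  then have dss: "disjoint_cycles dss"
    using dss'(1) set_dss mset_eq_imp_distinct_iff unfolding disjoint_cycles_def by metis
  have lens': "map ?l css = map ?l dss"
    using f by (simp add: dss_def permute_list_map)
  \<comment> \<open>The lengths can be recovered from the truncated differences because every cycle
    has at least two entries.\<close>
  have lens: "map length css = map length dss"
  proof (rule nth_equalityI)
    show "length (map length css) = length (map length dss)"
      using lens' by (metis length_map)
  next
    fix i
    assume "i < length (map length css)"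
    then have i: "i < length css" "i < length dss"
      using lens' by (auto dest: map_eq_imp_length_eq)
    have "?l (css ! i) = ?l (dss ! i)"
      using lens' i by (metis nth_map)
    moreover have "2 \<le> length (css ! i)" "2 \<le> length (dss ! i)"
      using css(1) dss i by (simp_all add: disjoint_cycles_def)
    ultimately show "map length css ! i = map length dss ! i"
      using i by simp
  qed
  obtain g where g: "g \<in> carrier (fin_alt_group X)" "map g (concat css) = concat dss"
  proof (rule exists_even_permutation_map[OF assms(1)])
    show "length (concat css) = length (concat dss)"
      by (simp add: length_concat lens)
    show "set (concat css) \<subseteq> X" "set (concat dss) \<subseteq> X"
      using in_X set_dss by simp_all
  qed (use css(1) dss in \<open>simp_all add: disjoint_cycles_def\<close>)
  have bij: "bij g"
    using g(1) permutes_bij by (auto simp: carrier_fin_alt_group)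
  have "g \<circ> p \<circ> inv_into UNIV g = perm_of_cycles dss"
    using conjugate_perm_of_cycles[OF bij, of css] map_map_concat_eq[OF lens g(2)] css
    by (simp add: disjoint_cycles_def)
  also have "\<dots> = q"
    unfolding dss'(2)[symmetric] using dss dss'(1) set_dss
    by (intro perm_of_cycles_cong) (simp_all add: disjoint_cycles_def)
  finally show ?thesis
    using that g(1) by metis
qed

lemma conj_class_fin_alt_group:
  assumes "infinite X" "p \<in> carrier (fin_alt_group X)"
  shows "conj_class (fin_alt_group X) p =
    {q \<in> carrier (fin_alt_group X). reduced_cycle_type q = reduced_cycle_type p}"
proof (intro equalityI subsetI)
  fix q
  assume "q \<in> conj_class (fin_alt_group X) p"
  then obtain g where g: "g \<in> carrier (fin_alt_group X)"
    and q: "q = g \<otimes>\<^bsub>fin_alt_group X\<^esub> p \<otimes>\<^bsub>fin_alt_group X\<^esub> inv\<^bsub>fin_alt_group X\<^esub> g"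
    unfolding conj_class_def orbit_def by blast
  have "q \<in> carrier (fin_alt_group X)"
  proof -
    interpret group "fin_alt_group X"
      by (rule group_fin_alt_group)
    show ?thesis
      unfolding q by (rule m_closed[OF m_closed[OF g assms(2)] inv_closed[OF g]])
  qed
  moreover have "q = g \<circ> p \<circ> inv_into UNIV g"
    unfolding q mult_fin_alt_group m_inv_fin_alt_group[OF g] ..
  moreover have "permutation p" "bij g"
    using g assms(2) by (auto simp: carrier_fin_alt_group intro: permutes_bij)
  then have "reduced_cycle_type (g \<circ> p \<circ> inv_into UNIV g) = reduced_cycle_type p"
    by (rule reduced_cycle_type_conjugate)
  ultimately show "q \<in> {q \<in> carrier (fin_alt_group X). reduced_cycle_type q = reduced_cycle_type p}"
    by simp
next
  fix q
  assume "q \<in> {q \<in> carrier (fin_alt_group X). reduced_cycle_type q = reduced_cycle_type p}"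
  then have "q \<in> carrier (fin_alt_group X)" "reduced_cycle_type p = reduced_cycle_type q"
    by simp_all
  then obtain g where g: "g \<in> carrier (fin_alt_group X)" "g \<circ> p \<circ> inv_into UNIV g = q"
    by (rule conjugate_in_fin_alt_group[OF assms])
  have "q = g \<otimes>\<^bsub>fin_alt_group X\<^esub> p \<otimes>\<^bsub>fin_alt_group X\<^esub> inv\<^bsub>fin_alt_group X\<^esub> g"
    unfolding mult_fin_alt_group m_inv_fin_alt_group[OF g(1)] using g(2) by (rule sym)
  then show "q \<in> conj_class (fin_alt_group X) p"
    unfolding conj_class_def orbit_def using g(1) by blast
qed

text \<open>Word length depends only on the reduced cycle type, so it is constant on the class and
  the minimum is attained at \<open>p\<close> itself.\<close>

lemma conj_length_fin_alt_group:
  assumes "infinite X" "p \<in> carrier (fin_alt_group X)"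
  shows "2 * conj_length (fin_alt_group X) (alt_generators X) p = sum_mset (reduced_cycle_type p)"
proof -
  let ?l = "word_length (fin_alt_group X) (alt_generators X)"
  have const: "?l q = ?l p" if "q \<in> conj_class (fin_alt_group X) p" for q
    using that word_length_fin_alt_group[of q X] word_length_fin_alt_group[OF assms(2)]
    unfolding conj_class_fin_alt_group[OF assms] by simp
  have "p \<in> conj_class (fin_alt_group X) p"
    unfolding conj_class_fin_alt_group[OF assms] using assms(2) by simp
  then have "conj_length (fin_alt_group X) (alt_generators X) p = ?l p"
    unfolding conj_length_def
  proof (intro Least_equality)
    fix n
    assume "\<exists>q \<in> conj_class (fin_alt_group X) p. ?l q = n"
    then obtain q where "q \<in> conj_class (fin_alt_group X) p" "n = ?l q"
      by blast
    then show "?l p \<le> n"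
      using const[of q] by linarith
  qed blast
  then show ?thesis
    using word_length_fin_alt_group[OF assms(2)] by simp
qed

section \<open>Realising types and counting the classes of given length\<close>

lemma exists_disjoint_cycles_of_lengths:
  assumes "infinite X" "0 \<notin> set ms"
  shows "\<exists>css. disjoint_cycles css \<and> set (concat css) \<subseteq> X \<and> map (\<lambda>c. length c - 1) css = ms"
  using assms(2)
proof (induction ms)
  case Nil
  then show ?case
    by (simp add: disjoint_cycles_def)
next
  case (Cons m ms)
  then obtain css where css: "disjoint_cycles css" "set (concat css) \<subseteq> X"
    "map (\<lambda>c. length c - 1) css = ms"
    by auto
  have "infinite (X - set (concat css))"
    using assms(1) by simp
  \<comment> \<open>A part \<open>m\<close> stands for a cycle of \<open>Suc m\<close> points; the
    infinite set \<open>X\<close> always has room for them outside the cycles already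
    chosen.\<close>
  then obtain A where A: "A \<subseteq> X - set (concat css)" "finite A" "card A = Suc m"
    by (meson infinite_arbitrarily_large)
  obtain c where c: "set c = A" "distinct c"
    using finite_distinct_list[OF A(2)] by auto
  then have "length c = Suc m"
    using A(3) distinct_card[of c] by simp
  moreover have "0 < m"
    using Cons.prems by simp
  ultimately have "disjoint_cycles (c # css)" "set (concat (c # css)) \<subseteq> X"
    "map (\<lambda>c. length c - 1) (c # css) = m # ms"
    using A(1) c css by (auto simp: disjoint_cycles_Cons)
  then show ?case
    by (intro exI[of _ "c # css"] conjI)
qed

lemma exists_reduced_cycle_type:
  assumes "infinite X" "0 \<notin># M" "even (sum_mset M)"
  obtains p where "p \<in> carrier (fin_alt_group X)" "reduced_cycle_type p = M"
proof -
  obtain ms where ms: "mset ms = M"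
    using ex_mset by blast
  then have "0 \<notin> set ms"
    using assms(2) by auto
  then obtain css where css: "disjoint_cycles css" "set (concat css) \<subseteq> X"
    "map (\<lambda>c. length c - 1) css = ms"
    using exists_disjoint_cycles_of_lengths[OF assms(1)] by blast
  have type: "reduced_cycle_type (perm_of_cycles css) = M"
    using reduced_cycle_type_perm_of_cycles[OF css(1)] unfolding css(3) ms .
  moreover have "perm_of_cycles css \<in> carrier (fin_alt_group X)"
    using perm_of_cycles_permutes[OF css(2)] permutation_perm_of_cycles[of css]
      evenperm_iff_reduced_cycle_type[of "perm_of_cycles css"] type assms(3)
    by (simp add: carrier_fin_alt_group)
  ultimately show ?thesis
    using that by blast
qed

lemma conj_classes_of_length_fin_alt_group:
  assumes "infinite X"
  shows "bij_betw (\<lambda>M. {p \<in> carrier (fin_alt_group X). reduced_cycle_type p = M})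
    {M. 0 \<notin># M \<and> sum_mset M = 2 * n}
    (conj_classes_of_length (fin_alt_group X) (alt_generators X) n)"
    (is "bij_betw ?F ?P ?C")
proof (rule bij_betw_imageI)
  \<comment> \<open>Realisability of each type gives injectivity: a nonempty fibre determines its
    type.\<close>
  have nonempty: "?F M \<noteq> {}" if "M \<in> ?P" for M
  proof -
    have "0 \<notin># M" "even (sum_mset M)"
      using that by simp_all
    then obtain p where "p \<in> carrier (fin_alt_group X)" "reduced_cycle_type p = M"
      by (rule exists_reduced_cycle_type[OF assms])
    then show ?thesis
      by blast
  qed
  show "inj_on ?F ?P"
  proof (rule inj_onI)
    fix M N
    assume "M \<in> ?P" and eq: "?F M = ?F N"
    then obtain p where "p \<in> ?F M"
      using nonempty[of M] by blast
    moreover from this have "p \<in> ?F N"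
      unfolding eq .
    ultimately show "M = N"
      by simp
  qed
  have class_eq: "conj_class (fin_alt_group X) p = ?F (reduced_cycle_type p)"
    if "p \<in> carrier (fin_alt_group X)" for p
    using conj_class_fin_alt_group[OF assms that] .
  show "?F ` ?P = ?C"
  proof (intro equalityI subsetI)
    fix K
    assume "K \<in> ?F ` ?P"
    then obtain M where M: "0 \<notin># M" "sum_mset M = 2 * n" "K = ?F M"
      by blast
    then have "even (sum_mset M)"
      by simp
    then obtain p where p: "p \<in> carrier (fin_alt_group X)" "reduced_cycle_type p = M"
      by (rule exists_reduced_cycle_type[OF assms M(1)])
    have K: "K = conj_class (fin_alt_group X) p"
      unfolding class_eq[OF p(1)] M(3) p(2) ..
    have "conj_length (fin_alt_group X) (alt_generators X) q = n" if "q \<in> K" for q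
    proof -
      have "q \<in> carrier (fin_alt_group X)" "reduced_cycle_type q = M"
        using that unfolding M(3) by simp_all
      then show ?thesis
        using conj_length_fin_alt_group[OF assms, of q] M(2) by simp
    qed
    then show "K \<in> ?C"
      unfolding conj_classes_of_length_def using K p(1) by blast
  next
    fix K
    assume "K \<in> ?C"
    then have "K \<in> conj_class (fin_alt_group X) ` carrier (fin_alt_group X)"
      and len: "\<forall>q \<in> K. conj_length (fin_alt_group X) (alt_generators X) q = n"
      unfolding conj_classes_of_length_def by simp_all
    then obtain p where p: "p \<in> carrier (fin_alt_group X)" "K = conj_class (fin_alt_group X) p"
      by blast
    have K: "K = ?F (reduced_cycle_type p)"
      unfolding p(2) by (rule class_eq[OF p(1)])
    then have "conj_length (fin_alt_group X) (alt_generators X) p = n"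
      using len p(1) by simp
    then have "reduced_cycle_type p \<in> ?P"
      using p(1) conj_length_fin_alt_group[OF assms p(1)] zero_notin_reduced_cycle_type[of p]
      by (simp add: carrier_fin_alt_group)
    then show "K \<in> ?F ` ?P"
      using K by (rule rev_image_eqI)
  qed
qed

section \<open>Counting partitions\<close>

text \<open>This computes the number of partitions of \<open>m\<close> into parts of size at most
  \<open>k\<close>; the recursion splits on whether the part \<open>Suc k\<close> occurs. The guard
  ensures that the part fits, so that the subtraction is exact.\<close>

fun count_partitions :: "nat \<Rightarrow> nat \<Rightarrow> nat" where
  "count_partitions 0 m = (if m = 0 then 1 else 0)"
| "count_partitions (Suc k) m =
     count_partitions k m + (if k < m then count_partitions (Suc k) (m - Suc k) else 0)"

declare count_partitions.simps(2) [simp del]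

definition partitions_le :: "nat \<Rightarrow> nat \<Rightarrow> nat multiset set" where
  "partitions_le k m = {M. 0 \<notin># M \<and> sum_mset M = m \<and> (\<forall>x \<in># M. x \<le> k)}"

lemma partitions_le_0: "partitions_le 0 m = (if m = 0 then {{#}} else {})"
proof -
  have "M \<in> partitions_le 0 m \<longleftrightarrow> M = {#} \<and> m = 0" for M
    by (cases M) (auto simp: partitions_le_def)
  then show ?thesis
    by auto
qed

text \<open>If the largest admissible part occurs, removing one copy leaves a partition under the
  same bound; otherwise the bound drops to \<open>k\<close>.\<close>

lemma partitions_le_Suc:
  "partitions_le (Suc k) m = partitions_le k m \<union>
     (if k < m then add_mset (Suc k) ` partitions_le (Suc k) (m - Suc k) else {})"
    (is "_ = _ \<union> ?R")
proof (rule Set.set_eqI)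
  fix M
  show "M \<in> partitions_le (Suc k) m \<longleftrightarrow> M \<in> partitions_le k m \<union> ?R"
  proof (cases "Suc k \<in># M")
    case True
    then obtain N where N: "M = add_mset (Suc k) N"
      by (metis multi_member_split)
    have "M \<notin> partitions_le k m"
      unfolding N partitions_le_def by simp
    moreover have "M \<in> ?R \<longleftrightarrow> k < m \<and> N \<in> partitions_le (Suc k) (m - Suc k)"
      unfolding N by auto
    moreover have "M \<in> partitions_le (Suc k) m \<longleftrightarrow> k < m \<and> N \<in> partitions_le (Suc k) (m - Suc k)"
      unfolding N partitions_le_def by auto
    ultimately show ?thesis
      by blast
  next
    case False
    then have "(\<forall>x \<in># M. x \<le> Suc k) \<longleftrightarrow> (\<forall>x \<in># M. x \<le> k)"
      by (metis le_Suc_eq)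
    moreover have "M \<notin> ?R"
      using False by auto
    ultimately show ?thesis
      unfolding partitions_le_def by simp
  qed
qed

text \<open>The two pieces of the split are disjoint and adding a fixed part is injective.
  Finiteness is proved simultaneously because the cardinality of the union depends on it.\<close>

lemma card_partitions_le:
  "finite (partitions_le k m) \<and> card (partitions_le k m) = count_partitions k m"
proof (induction k m rule: count_partitions.induct)
  case (1 m)
  show ?case
    by (simp add: partitions_le_0)
next
  case (2 k m)
  show ?case
  proof (cases "k < m")
    case True
    let ?Q = "add_mset (Suc k) ` partitions_le (Suc k) (m - Suc k)"
    note IH = "2.IH"(1)[THEN conjunct1] "2.IH"(1)[THEN conjunct2]
      "2.IH"(2)[OF True, THEN conjunct1] "2.IH"(2)[OF True, THEN conjunct2]
    have "M \<notin> ?Q" if "M \<in> partitions_le k m" for M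
    proof -
      have "\<forall>x \<in># M. x \<le> k"
        using that by (simp add: partitions_le_def)
      then have "Suc k \<notin># M"
        using Suc_n_not_le_n by blast
      then show ?thesis
        by auto
    qed
    then have "partitions_le k m \<inter> ?Q = {}"
      by blast
    then have "card (partitions_le k m \<union> ?Q) = card (partitions_le k m) + card ?Q"
      by (rule card_Un_disjoint[OF IH(1) finite_imageI[OF IH(3)]])
    moreover have "card ?Q = card (partitions_le (Suc k) (m - Suc k))"
      by (intro card_image inj_onI) simp
    ultimately show ?thesis
      unfolding partitions_le_Suc[of k m] count_partitions.simps(2)[of k m] if_P[OF True]
      using IH(1,3) unfolding IH(2,4) by simp
  next
    case False
    then show ?thesis
      unfolding partitions_le_Suc[of k m] count_partitions.simps(2)[of k m] if_not_P[OF False]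
      using "2.IH"(1) by simp
  qed
qed

text \<open>A part never exceeds the total, so the bound \<open>m\<close> excludes nothing.\<close>

lemma partitions_eq_partitions_le:
  "{M :: nat multiset. 0 \<notin># M \<and> sum_mset M = m} = partitions_le m m"
proof -
  have "x \<le> sum_mset M" if "x \<in># M" for x and M :: "nat multiset"
    using multi_member_split[OF that] by auto
  then show ?thesis
    unfolding partitions_le_def by auto
qed

lemma finite_partitions: "finite {M :: nat multiset. 0 \<notin># M \<and> sum_mset M = m}"
  by (simp add: partitions_eq_partitions_le card_partitions_le)

lemma num_partitions_eq_count_partitions: "num_partitions m = count_partitions m m"
  by (simp add: num_partitions_def partitions_eq_partitions_le card_partitions_le)

section \<open>Numerical evaluation of partition numbers\<close>

lemma count_partitions_1: "count_partitions (Suc 0) m = 1"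
proof (induction m rule: less_induct)
  case (less m)
  then show ?case
    using count_partitions.simps(2)[of 0 m] by simp
qed

text \<open>The recursion is restated for numerals so that simplification can compute concrete
  values; it ends at the bound \<open>Suc 0\<close>.\<close>

lemma count_partitions_numeral:
  "count_partitions (numeral k) m = count_partitions (pred_numeral k) m +
     (if numeral k \<le> m then count_partitions (numeral k) (m - numeral k) else 0)"
  using count_partitions.simps(2)[of "pred_numeral k" m] by (simp add: numeral_eq_Suc Suc_le_eq)

theorem proposition24:
  fixes X :: "'a set"
  assumes "infinite X"
  shows "has_conj_growth_series (fin_alt_group X) (three_cycles X \<union> double_transpositions X) \<and>
    conj_growth_series (fin_alt_group X) (three_cycles X \<union> double_transpositions X) =
      Abs_fps (\<lambda>m. num_partitions (2 * m)) \<and>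
    map (fps_nth (conj_growth_series (fin_alt_group X)
           (three_cycles X \<union> double_transpositions X))) [0..<13] =
      [1, 2, 5, 11, 22, 42, 77, 135, 231, 385, 627, 1002, 1575]"
proof -
  have "finite (conj_classes_of_length (fin_alt_group X) (alt_generators X) n)" for n
    \<comment> \<open>Finiteness is transported from the set of partitions of
      \<open>2 * n\<close>.\<close>
    using bij_betw_finite[OF conj_classes_of_length_fin_alt_group[OF assms]] finite_partitions
    by blast
  then have "has_conj_growth_series (fin_alt_group X) (alt_generators X)"
    unfolding has_conj_growth_series_def
    by (intro conjI allI group_fin_alt_group alt_generators_subset generate_alt_generators)
  moreover have "conj_growth (fin_alt_group X) (alt_generators X) n = num_partitions (2 * n)" for n
    using bij_betw_same_card[OF conj_classes_of_length_fin_alt_group[OF assms]]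
    unfolding conj_growth_def num_partitions_def by (rule sym)
  then have "conj_growth (fin_alt_group X) (alt_generators X) = (\<lambda>n. num_partitions (2 * n))"
    by (rule ext)
  then have "conj_growth_series (fin_alt_group X) (alt_generators X) =
      Abs_fps (\<lambda>m. num_partitions (2 * m))"
    unfolding conj_growth_series_def by (rule arg_cong)
  moreover have "map (\<lambda>m. num_partitions (2 * m)) [0..<13] =
      [1, 2, 5, 11, 22, 42, 77, 135, 231, 385, 627, 1002, 1575]"
    by (simp add: num_partitions_eq_count_partitions count_partitions_numeral count_partitions_1
        upt_conv_Cons)
  \<comment> \<open>This turns the coefficient list of the series into the list of partition numbers
    just evaluated.\<close>
  moreover have "fps_nth (Abs_fps f) = f" for f :: "nat \<Rightarrow> nat"
    by (rule ext) simp
  ultimately show ?thesis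
    by (simp only:)
qed

end
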